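(* Let $\gamma>0$ and $L>0$. Let $h:\mathbb{R}^n\to\mathbb{R}$ be differentiable with $L$-Lipschitz gradient and strongly quasiconvex with modulus $\gamma$, and let $\overline{x}$ be its minimizer, $\{\overline{x}\}=\operatorname{argmin}_{\mathbb{R}^n}h$. Let $\theta\in\,]0,1[$ and $\beta\in\,\left]0,\frac{1-\theta^2}{L}\right]$. Then the sequence $\{x_k\}_k$ generated by the heavy ball method $$x_{k+1}=x_k+\theta(x_k-x_{k-1})-\beta\nabla h(x_k),\qquad k\ge1,$$ from initial points $x_0,x_1\in\mathbb{R}^n$, converges linearly to $\overline{x}$, and the sequence $\{h(x_k)\}_k$ converges linearly to the optimal value $h^*=h(\overline{x})$.
   Context: $\|\cdot\|$ is the Euclidean norm on $\mathbb{R}^n$. A function $h:\mathbb{R}^n\to\mathbb{R}$ is strongly quasiconvex with modulus $\gamma>0$ if for all $x,y\in\mathbb{R}^n$ and all $\lambda\in[0,1]$, $$h(\lambda y+(1-\lambda)x)\le\max\{h(y),h(x)\}-\lambda(1-\lambda)\frac{\gamma}{2}\|x-y\|^2.$$ It is known that a lower semicontinuous strongly quasiconvex function on $\mathbb{R}^n$ has exactly one minimizer. The gradient is $L$-Lipschitz if $\|\nabla h(x)-\nabla h(y)\|\le L\|x-y\|$ for all $x,y\in\mathbb{R}^n$. Linear convergence is meant in the sense of a geometric bound: there are constants $C\ge0$ and $q\in\,]0,1[$ with $\|x_k-\overline{x}\|\le Cq^k$, respectively $h(x_k)-h^*\le Cq^k$, for all $k$. *)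

theory Defs
  imports "HOL-Analysis.Analysis"
begin

definition strongly_quasiconvex :: "real \<Rightarrow> ('a::real_normed_vector \<Rightarrow> real) \<Rightarrow> bool" where
  "strongly_quasiconvex \<gamma> h \<longleftrightarrow> \<gamma> > 0 \<and>
     (\<forall>x y. \<forall>t\<in>{0..1}.
        h (t *\<^sub>R y + (1 - t) *\<^sub>R x) \<le> max (h y) (h x) - t * (1 - t) * (\<gamma> / 2) * (norm (x - y))\<^sup>2)"

text \<open>The recursion starts at index 1, so \<open>x 0\<close> and \<open>x 1\<close> are arbitrary initial points;
  \<open>g\<close> plays the role of the gradient map.\<close>

definition heavy_ball ::
    "real \<Rightarrow> real \<Rightarrow> ('a::real_vector \<Rightarrow> 'a) \<Rightarrow> (nat \<Rightarrow> 'a) \<Rightarrow> bool" where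
  "heavy_ball \<theta> \<beta> g x \<longleftrightarrow>
     (\<forall>k\<ge>1. x (k + 1) = x k + \<theta> *\<^sub>R (x k - x (k - 1)) - \<beta> *\<^sub>R g (x k))"

text \<open>Geometric decay of a sequence of (one-sided) error values.\<close>

definition geometric_bound :: "(nat \<Rightarrow> real) \<Rightarrow> bool" where
  "geometric_bound e \<longleftrightarrow> (\<exists>C\<ge>0. \<exists>q. 0 < q \<and> q < 1 \<and> (\<forall>k. e k \<le> C * q ^ k))"

end

theory Submission
  imports Defs
begin

text \<open>Write \<open>d\<^sub>k = x\<^sub>k - x\<^sub>k\<^sub>-\<^sub>1\<close>. Strong quasiconvexity bounds the distance to the minimizer by a
  multiple of the gradient norm, which together with smoothness yields a Polyak-Lojasiewicz
  inequality. The descent lemma and \<open>\<beta> L \<le> 1 - \<theta>\<^sup>2\<close> show that the energy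
  \<open>h x\<^sub>k - h\<^sup>* + c \<parallel>d\<^sub>k\<parallel>\<^sup>2\<close> changes in one step by at most
  \<open>(2 \<theta> \<langle>d\<^sub>k, d\<^sub>k\<^sub>+\<^sub>1\<rangle> - (1 + \<theta>\<^sup>2) \<parallel>d\<^sub>k\<^sub>+\<^sub>1\<parallel>\<^sup>2) / (2 \<beta>) + c \<parallel>d\<^sub>k\<^sub>+\<^sub>1\<parallel>\<^sup>2 - c \<parallel>d\<^sub>k\<parallel>\<^sup>2\<close>.
  The obvious weight \<open>c = 1 / (2 \<beta>)\<close> makes this form only semidefinite when \<open>\<beta> L = 1 - \<theta>\<^sup>2\<close>;
  with \<open>c = \<theta> / (2 \<beta>)\<close> it is negative definite, and since \<open>\<beta> \<nabla>h(x\<^sub>k) = \<theta> d\<^sub>k - d\<^sub>k\<^sub>+\<^sub>1\<close> the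
  Polyak-Lojasiewicz inequality turns the decrease into a contraction of the energy.\<close>

section \<open>Quadratic bounds from a Lipschitz gradient\<close>

lemma lipschitz_gradient_upper_bound:
  fixes h :: "'a::real_inner \<Rightarrow> real"
  assumes grad: "\<And>z. GDERIV h z :> g z" and lip: "L-lipschitz_on UNIV g"
  shows "h (x + v) \<le> h x + g x \<bullet> v + L / 2 * (norm v)\<^sup>2"
proof -
  \<comment> \<open>The gap between \<open>h\<close> along the segment and its quadratic model. The
    Lipschitz bound and Cauchy-Schwarz make its slope nonpositive, so monotonicity replaces
    integrating the gradient.\<close>
  define \<phi> where "\<phi> = (\<lambda>t. h (x + t *\<^sub>R v) - t * (g x \<bullet> v) - L / 2 * t\<^sup>2 * (norm v)\<^sup>2)"
  have "\<phi> 1 \<le> \<phi> 0"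
  proof (rule DERIV_nonpos_imp_nonincreasing[of 0 1 \<phi>])
    fix t :: real
    assume "0 \<le> t" "t \<le> 1"
    let ?D = "(g (x + t *\<^sub>R v) - g x) \<bullet> v - L * t * (norm v)\<^sup>2"
    have "(h has_derivative (\<lambda>u. u \<bullet> g (x + t *\<^sub>R v))) (at (x + t *\<^sub>R v))"
      using grad[of "x + t *\<^sub>R v"] by (simp add: gderiv_def)
    moreover have "((\<lambda>t. x + t *\<^sub>R v) has_derivative (\<lambda>s. s *\<^sub>R v)) (at t)"
      by (auto intro!: derivative_eq_intros)
    ultimately have "((\<lambda>t. h (x + t *\<^sub>R v)) has_derivative (\<lambda>s. s *\<^sub>R v \<bullet> g (x + t *\<^sub>R v))) (at t)"
      by (rule has_derivative_compose[rotated])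
    then have "DERIV (\<lambda>t. h (x + t *\<^sub>R v)) t :> g (x + t *\<^sub>R v) \<bullet> v"
      by (simp add: has_field_derivative_def inner_commute mult_commute_abs)
    then have "DERIV \<phi> t :> ?D"
      unfolding \<phi>_def by (auto intro!: derivative_eq_intros simp: inner_diff_left)
    moreover have "?D \<le> 0"
    proof -
      have "norm (g (x + t *\<^sub>R v) - g x) \<le> L * (t * norm v)"
        using lipschitz_onD[OF lip, of "x + t *\<^sub>R v" x] \<open>0 \<le> t\<close> by (simp add: dist_norm)
      then have "norm (g (x + t *\<^sub>R v) - g x) * norm v \<le> L * (t * norm v) * norm v"
        by (rule mult_right_mono) simp
      then show ?thesis
        using norm_cauchy_schwarz[of "g (x + t *\<^sub>R v) - g x" v]
        by (simp add: power2_eq_square mult_ac)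
    qed
    ultimately show "\<exists>y. DERIV \<phi> t :> y \<and> y \<le> 0" by blast
  qed simp
  then show ?thesis by (simp add: \<phi>_def)
qed

text \<open>Apply the upper bound to \<open>- h\<close>, whose gradient has the same Lipschitz
  constant.\<close>

lemma lipschitz_gradient_lower_bound:
  fixes h :: "'a::real_inner \<Rightarrow> real"
  assumes grad: "\<And>z. GDERIV h z :> g z" and lip: "L-lipschitz_on UNIV g"
  shows "h x + g x \<bullet> v - L / 2 * (norm v)\<^sup>2 \<le> h (x + v)"
proof -
  have "L-lipschitz_on UNIV (\<lambda>z. - g z)"
    using lip by (simp add: lipschitz_on_minus_iff)
  from lipschitz_gradient_upper_bound[OF GDERIV_minus[OF grad] this, of x v]
  show ?thesis by simp
qed

section \<open>Error bounds from strong quasiconvexity\<close>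

lemma strongly_quasiconvexD:
  assumes "strongly_quasiconvex \<gamma> h" and "0 \<le> t" "t \<le> 1"
  shows "h (t *\<^sub>R y + (1 - t) *\<^sub>R x) \<le> max (h y) (h x) - t * (1 - t) * (\<gamma> / 2) * (norm (x - y))\<^sup>2"
  using assms unfolding strongly_quasiconvex_def by auto

text \<open>Moving from \<open>y\<close> towards \<open>z\<close> lowers \<open>h\<close> by the
  quasiconvexity term, since the maximum is \<open>h y\<close>; the quadratic lower bound forces the
  slope to account for this drop. Comparing at one fixed \<open>t\<close> avoids the limit
  \<open>t\<close> to 0, at the price of \<gamma>/4 in place of \<gamma>/2.\<close>

lemma strongly_quasiconvex_grad_norm_ge:
  fixes h :: "'a::real_inner \<Rightarrow> real"
  assumes grad: "\<And>z. GDERIV h z :> g z" and lip: "L-lipschitz_on UNIV g"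
    and qc: "strongly_quasiconvex \<gamma> h" and le: "h z \<le> h y"
  shows "\<gamma> / 4 * norm (y - z) \<le> norm (g y)"
proof -
  have \<gamma>: "\<gamma> > 0" using qc by (simp add: strongly_quasiconvex_def)
  have L: "L \<ge> 0" using lip by (rule lipschitz_on_nonneg)
  define r where "r = norm (y - z)"
  \<comment> \<open>chosen so that \<open>(1 - t) * \<gamma> - t * L = \<gamma> / 2\<close>\<close>
  define t where "t = \<gamma> / (2 * (\<gamma> + L))"
  have t: "0 < t" "t \<le> 1" and tL: "t * (\<gamma> + L) = \<gamma> / 2"
    using \<gamma> L by (auto simp: t_def field_simps)
  have "t *\<^sub>R z + (1 - t) *\<^sub>R y = y + t *\<^sub>R (z - y)" by (simp add: algebra_simps)
  then have up: "h (y + t *\<^sub>R (z - y)) \<le> h y - t * (1 - t) * (\<gamma> / 2) * r\<^sup>2"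
    using strongly_quasiconvexD[OF qc, of t z y] t le by (simp add: r_def)
  have lo: "h y + g y \<bullet> (t *\<^sub>R (z - y)) - L / 2 * (norm (t *\<^sub>R (z - y)))\<^sup>2 \<le> h (y + t *\<^sub>R (z - y))"
    by (rule lipschitz_gradient_lower_bound[OF grad lip])
  have inner_eq: "g y \<bullet> (t *\<^sub>R (z - y)) = - (t * (g y \<bullet> (y - z)))"
    by (simp add: inner_diff_right algebra_simps)
  have norm_eq: "(norm (t *\<^sub>R (z - y)))\<^sup>2 = t\<^sup>2 * r\<^sup>2"
    by (simp add: r_def power_mult_distrib norm_minus_commute)
  have "t * (1 - t) * (\<gamma> / 2) * r\<^sup>2 - L / 2 * (t\<^sup>2 * r\<^sup>2) \<le> t * (g y \<bullet> (y - z))"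
    using up lo[unfolded inner_eq norm_eq] by linarith
  then have "t * (((\<gamma> - t * (\<gamma> + L)) / 2) * r\<^sup>2) \<le> t * (g y \<bullet> (y - z))"
    by (simp add: power2_eq_square field_simps)
  then have "\<gamma> / 4 * r\<^sup>2 \<le> g y \<bullet> (y - z)"
    using t unfolding tL by simp
  also have "\<dots> \<le> norm (g y) * r"
    unfolding r_def by (rule norm_cauchy_schwarz)
  finally have "r * (\<gamma> / 4 * r) \<le> r * norm (g y)"
    by (simp add: power2_eq_square mult_ac)
  then show ?thesis
    by (cases "r = 0") (auto simp: r_def)
qed

text \<open>The quadratic lower bound at \<open>y\<close> estimates the gap by a linear and a
  quadratic term in \<open>norm (z - y)\<close>. Replacing this distance by 4/\<gamma> times the
  gradient norm yields the two summands of the constant.\<close>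

lemma strongly_quasiconvex_polyak_lojasiewicz:
  fixes h :: "'a::real_inner \<Rightarrow> real"
  assumes grad: "\<And>z. GDERIV h z :> g z" and lip: "L-lipschitz_on UNIV g"
    and qc: "strongly_quasiconvex \<gamma> h" and le: "h z \<le> h y"
  shows "h y - h z \<le> (4 / \<gamma> + 8 * L / \<gamma>\<^sup>2) * (norm (g y))\<^sup>2"
proof -
  have \<gamma>: "\<gamma> > 0" using qc by (simp add: strongly_quasiconvex_def)
  have L: "L \<ge> 0" using lip by (rule lipschitz_on_nonneg)
  have r: "norm (z - y) \<le> 4 / \<gamma> * norm (g y)"
    using strongly_quasiconvex_grad_norm_ge[OF grad lip qc le] \<gamma>
    by (simp add: field_simps norm_minus_commute)
  have "h y - h z \<le> - (g y \<bullet> (z - y)) + L / 2 * (norm (z - y))\<^sup>2"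
    using lipschitz_gradient_lower_bound[OF grad lip, of y "z - y"] by simp
  also have "\<dots> \<le> norm (g y) * norm (z - y) + L / 2 * (norm (z - y))\<^sup>2"
    using Cauchy_Schwarz_ineq2[of "g y" "z - y"] by linarith
  also have "\<dots> \<le> norm (g y) * (4 / \<gamma> * norm (g y)) + L / 2 * (4 / \<gamma> * norm (g y))\<^sup>2"
    using r L by (intro add_mono mult_left_mono power_mono) auto
  also have "\<dots> = (4 / \<gamma> + 8 * L / \<gamma>\<^sup>2) * (norm (g y))\<^sup>2"
    by (simp add: power2_eq_square algebra_simps)
  finally show ?thesis .
qed

text \<open>The value at the midpoint of \<open>y\<close> and \<open>z\<close> cannot fall below the
  minimum \<open>h z\<close>. This later turns decay of values into decay of distances.\<close>

lemma strongly_quasiconvex_quadratic_growth: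
  fixes h :: "'a::real_normed_vector \<Rightarrow> real"
  assumes qc: "strongly_quasiconvex \<gamma> h" and min: "\<And>y. h z \<le> h y"
  shows "(norm (y - z))\<^sup>2 \<le> 8 / \<gamma> * (h y - h z)"
proof -
  have \<gamma>: "\<gamma> > 0" using qc by (simp add: strongly_quasiconvex_def)
  have "h ((1/2) *\<^sub>R z + (1 - 1/2) *\<^sub>R y) \<le> max (h z) (h y) - (1/2) * (1 - 1/2) * (\<gamma> / 2) * (norm (y - z))\<^sup>2"
    by (rule strongly_quasiconvexD[OF qc]) auto
  with min[of y] min[of "(1/2) *\<^sub>R z + (1 - 1/2) *\<^sub>R y"]
  have "\<gamma> / 8 * (norm (y - z))\<^sup>2 \<le> h y - h z" by simp
  with \<gamma> show ?thesis by (simp add: field_simps)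
qed

section \<open>Energy of a heavy ball step\<close>

lemma norm_add_square_le:
  fixes a b :: "'a::real_inner"
  shows "(norm (a + b))\<^sup>2 \<le> 2 * (norm a)\<^sup>2 + 2 * (norm b)\<^sup>2"
  using zero_le_power2[of "norm (a - b)"]
  by (simp add: power2_norm_eq_inner algebra_simps inner_commute)

lemma heavy_ball_energy_decrease:
  fixes h :: "'a::real_inner \<Rightarrow> real"
  assumes grad: "\<And>z. GDERIV h z :> g z" and lip: "L-lipschitz_on UNIV g"
    and \<beta>: "0 < \<beta>" and \<beta>L: "\<beta> * L \<le> 1 - \<theta>\<^sup>2"
    and d': "d' = \<theta> *\<^sub>R d - \<beta> *\<^sub>R g y"
  shows "h (y + d') + \<theta> / (2 * \<beta>) * (norm d')\<^sup>2 \<le> h y + \<theta> / (2 * \<beta>) * (norm d)\<^sup>2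
           - (\<theta> * (norm (d - d'))\<^sup>2 + (1 - \<theta>)\<^sup>2 * (norm d')\<^sup>2) / (2 * \<beta>)"
proof -
  \<comment> \<open>The update rule eliminates the gradient in favour of the two
    displacements.\<close>
  have gd: "\<beta> * (g y \<bullet> d') = \<theta> * (d \<bullet> d') - (norm d')\<^sup>2"
  proof -
    have "\<beta> *\<^sub>R g y = \<theta> *\<^sub>R d - d'" by (simp add: d')
    then have "(\<beta> *\<^sub>R g y) \<bullet> d' = (\<theta> *\<^sub>R d - d') \<bullet> d'" by simp
    then show ?thesis by (simp add: inner_diff_left power2_norm_eq_inner)
  qed
  have "2 * \<beta> * h (y + d') \<le> 2 * \<beta> * (h y + g y \<bullet> d' + L / 2 * (norm d')\<^sup>2)"
    using lipschitz_gradient_upper_bound[OF grad lip] \<beta> by (intro mult_left_mono) auto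
  also have "\<dots> = 2 * \<beta> * h y + 2 * (\<beta> * (g y \<bullet> d')) + (\<beta> * L) * (norm d')\<^sup>2"
    by (simp add: algebra_simps)
  also have "\<dots> \<le> 2 * \<beta> * h y + 2 * (\<theta> * (d \<bullet> d') - (norm d')\<^sup>2) + (1 - \<theta>\<^sup>2) * (norm d')\<^sup>2"
    unfolding gd using \<beta>L by (intro add_left_mono mult_right_mono) auto
  \<comment> \<open>Polarization of \<open>d \<bullet> d'\<close>, together with
    \<open>1 + \<theta>\<^sup>2 = 2 * \<theta> + (1 - \<theta>)\<^sup>2\<close>.\<close>
  also have "\<dots> = 2 * \<beta> * h y + \<theta> * (norm d)\<^sup>2 - \<theta> * (norm d')\<^sup>2
                  - (\<theta> * (norm (d - d'))\<^sup>2 + (1 - \<theta>)\<^sup>2 * (norm d')\<^sup>2)"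
    by (simp add: power2_norm_eq_inner inner_diff inner_commute[of d' d] power2_eq_square[of \<theta>]
        power2_eq_square[of "1 - \<theta>"] algebra_simps)
  finally have "(2 * \<beta> * h (y + d') + \<theta> * (norm d')\<^sup>2) / (2 * \<beta>) \<le> (2 * \<beta> * h y + \<theta> * (norm d)\<^sup>2
      - (\<theta> * (norm (d - d'))\<^sup>2 + (1 - \<theta>)\<^sup>2 * (norm d')\<^sup>2)) / (2 * \<beta>)"
    using \<beta> by (intro divide_right_mono) auto
  then show ?thesis
    using \<beta> unfolding add_divide_distrib diff_divide_distrib by simp
qed

text \<open>The decrease \<open>D / (2 * \<beta>)\<close> dominates both \<open>norm d\<close>
  squared and the squared gradient norm, hence by \<open>PL\<close> a fixed fraction
  \<open>1 / K\<close> of the whole energy.\<close>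

lemma heavy_ball_energy_contraction:
  fixes h :: "'a::real_inner \<Rightarrow> real"
  assumes grad: "\<And>z. GDERIV h z :> g z" and lip: "L-lipschitz_on UNIV g"
    and \<theta>: "0 < \<theta>" "\<theta> < 1" and \<beta>: "0 < \<beta>" and \<beta>L: "\<beta> * L \<le> 1 - \<theta>\<^sup>2"
    and A: "0 \<le> A" and PL: "\<And>y. h y - m \<le> A * (norm (g y))\<^sup>2"
  obtains q where "0 < q" "q < 1"
    "\<And>y d d'. d' = \<theta> *\<^sub>R d - \<beta> *\<^sub>R g y \<Longrightarrow>
       h (y + d') - m + \<theta> / (2 * \<beta>) * (norm d')\<^sup>2 \<le> q * (h y - m + \<theta> / (2 * \<beta>) * (norm d)\<^sup>2)"
proof
  \<comment> \<open>The first summand pays for the gap \<open>h y - m\<close>, the second for the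
    term in \<open>norm d\<close>.\<close>
  define K where "K = 4 * A / \<beta> + 2 * (1 + \<theta> / (1 - \<theta>)\<^sup>2)"
  have K: "K > 1"
  proof -
    have "0 \<le> 4 * A / \<beta>" and "1 < 2 * (1 + \<theta> / (1 - \<theta>)\<^sup>2)"
      using \<theta> \<beta> A by (auto simp: add_pos_nonneg)
    then show ?thesis unfolding K_def by simp
  qed
  show "0 < 1 - 1 / K" "1 - 1 / K < 1" using K by auto
  fix y d d' :: 'a
  assume d': "d' = \<theta> *\<^sub>R d - \<beta> *\<^sub>R g y"
  define p where "p = (norm (d - d'))\<^sup>2"
  define s where "s = (norm d')\<^sup>2"
  define D where "D = \<theta> * p + (1 - \<theta>)\<^sup>2 * s"
  define W where "W = h y - m + \<theta> / (2 * \<beta>) * (norm d)\<^sup>2"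
  have ps: "0 \<le> p" "0 \<le> s" by (auto simp: p_def s_def)
  \<comment> \<open>Written in \<open>d - d'\<close> and \<open>d'\<close>, the vectors whose
    squared norms make up \<open>D\<close>.\<close>
  have "\<beta> *\<^sub>R g y = \<theta> *\<^sub>R (d - d') + (- (1 - \<theta>)) *\<^sub>R d'"
    by (simp add: d' algebra_simps)
  then have "(norm (\<beta> *\<^sub>R g y))\<^sup>2 \<le> 2 * (norm (\<theta> *\<^sub>R (d - d')))\<^sup>2 + 2 * (norm ((- (1 - \<theta>)) *\<^sub>R d'))\<^sup>2"
    using norm_add_square_le by metis
  then have "\<beta>\<^sup>2 * (norm (g y))\<^sup>2 \<le> 2 * (\<theta>\<^sup>2 * p + (1 - \<theta>)\<^sup>2 * s)"
    by (simp add: power_mult_distrib p_def s_def power2_commute[of \<theta> 1])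
  also have "\<dots> \<le> 2 * D"
    using \<theta> ps by (simp add: D_def power2_eq_square mult_right_mono mult_left_le)
  finally have g: "(norm (g y))\<^sup>2 \<le> 2 * D / \<beta>\<^sup>2"
    using \<beta> by (simp add: field_simps)
  have "(norm d)\<^sup>2 \<le> 2 * p + 2 * s"
    using norm_add_square_le[of "d - d'" d'] by (simp add: p_def s_def)
  then have "\<theta> * (norm d)\<^sup>2 \<le> \<theta> * (2 * p + 2 * s)"
    using \<theta> by (intro mult_left_mono) auto
  also have "\<dots> \<le> 2 * (1 + \<theta> / (1 - \<theta>)\<^sup>2) * D"
  proof -
    have "\<theta> * p \<le> D" "s \<le> D / (1 - \<theta>)\<^sup>2"
      using \<theta> ps by (auto simp: D_def field_simps)
    then have "\<theta> * p + \<theta> * s \<le> D + \<theta> * (D / (1 - \<theta>)\<^sup>2)"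
      using \<theta> by (intro add_mono mult_left_mono) auto
    then have "2 * (\<theta> * p + \<theta> * s) \<le> 2 * (D + \<theta> * (D / (1 - \<theta>)\<^sup>2))"
      by (rule mult_left_mono) simp
    then show ?thesis by (simp add: algebra_simps)
  qed
  finally have dn: "\<theta> * (norm d)\<^sup>2 \<le> 2 * (1 + \<theta> / (1 - \<theta>)\<^sup>2) * D" .
  have "W \<le> A * (2 * D / \<beta>\<^sup>2) + (2 * (1 + \<theta> / (1 - \<theta>)\<^sup>2) * D) / (2 * \<beta>)"
  proof -
    have "h y - m \<le> A * (2 * D / \<beta>\<^sup>2)"
      using PL[of y] mult_left_mono[OF g A] by linarith
    moreover have "\<theta> / (2 * \<beta>) * (norm d)\<^sup>2 \<le> (2 * (1 + \<theta> / (1 - \<theta>)\<^sup>2) * D) / (2 * \<beta>)"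
      using divide_right_mono[OF dn, of "2 * \<beta>"] \<beta> by simp
    ultimately show ?thesis by (simp add: W_def)
  qed
  also have "\<dots> = K * (D / (2 * \<beta>))"
  proof -
    have "A * (2 * D / \<beta>\<^sup>2) = 4 * A / \<beta> * (D / (2 * \<beta>))"
      by (simp add: power2_eq_square)
    then show ?thesis unfolding K_def distrib_right by simp
  qed
  finally have "W / K \<le> D / (2 * \<beta>)" using K by (simp add: field_simps)
  moreover have "h (y + d') - m + \<theta> / (2 * \<beta>) * (norm d')\<^sup>2 \<le> W - D / (2 * \<beta>)"
    using heavy_ball_energy_decrease[OF grad lip \<beta> \<beta>L d']
    by (simp add: W_def D_def p_def s_def)
  ultimately have "h (y + d') - m + \<theta> / (2 * \<beta>) * (norm d')\<^sup>2 \<le> (1 - 1 / K) * W"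
    by (simp add: left_diff_distrib)
  then show "h (y + d') - m + \<theta> / (2 * \<beta>) * (norm d')\<^sup>2
      \<le> (1 - 1 / K) * (h y - m + \<theta> / (2 * \<beta>) * (norm d)\<^sup>2)"
    by (simp add: W_def)
qed

section \<open>Geometric bounds and convergence\<close>

lemma geometric_bound_of_contraction:
  assumes q: "0 < q" "q < 1" and step: "\<And>k. k \<ge> 1 \<Longrightarrow> e (Suc k) \<le> q * e k"
  shows "geometric_bound e"
proof -
  \<comment> \<open>Contraction starts at index 1, so \<open>C\<close> must cover \<open>e 0\<close>
    and \<open>e 1\<close> directly; dividing by \<open>q\<close> offsets the factor
    \<open>q ^ 1\<close>.\<close>
  define C where "C = max \<bar>e 0\<bar> (\<bar>e 1\<bar> / q)"
  have "e k \<le> C * q ^ k" for k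
  proof (induction k)
    case 0
    show ?case by (simp add: C_def)
  next
    case (Suc k)
    show ?case
    proof (cases k)
      case 0
      have "\<bar>e 1\<bar> / q * q \<le> C * q"
        using q by (intro mult_right_mono) (auto simp: C_def)
      then show ?thesis using q 0 by simp
    next
      case (Suc j)
      then have "e (Suc k) \<le> q * e k" by (intro step) simp
      also have "\<dots> \<le> q * (C * q ^ k)" using Suc.IH q by (intro mult_left_mono) auto
      finally show ?thesis by (simp add: mult_ac)
    qed
  qed
  moreover have "C \<ge> 0" by (simp add: C_def)
  ultimately show ?thesis using q unfolding geometric_bound_def by blast
qed

lemma geometric_bound_mono:
  assumes "geometric_bound e" and "\<And>k. f k \<le> e k"
  shows "geometric_bound f"
  using assms unfolding geometric_bound_def by (meson order_trans)

lemma geometric_bound_of_square: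
  assumes e: "geometric_bound e" and a: "a \<ge> 0" and f: "\<And>k. (f k)\<^sup>2 \<le> a * e k"
  shows "geometric_bound f"
proof -
  obtain C q where C: "C \<ge> 0" and q: "0 < q" "q < 1" and le: "\<And>k. e k \<le> C * q ^ k"
    using e unfolding geometric_bound_def by blast
  \<comment> \<open>Taking roots changes the rate from \<open>q\<close> to
    \<open>sqrt q\<close>.\<close>
  have "f k \<le> sqrt (a * C) * sqrt q ^ k" for k
  proof -
    have "(f k)\<^sup>2 \<le> a * (C * q ^ k)"
      using f[of k] mult_left_mono[OF le[of k] a] by linarith
    then have "f k \<le> sqrt (a * (C * q ^ k))" by (rule real_le_rsqrt)
    then show ?thesis by (simp add: real_sqrt_mult real_sqrt_power mult_ac)
  qed
  moreover have "0 < sqrt q" "sqrt q < 1" using q by auto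
  moreover have "sqrt (a * C) \<ge> 0" using a C by simp
  ultimately show ?thesis unfolding geometric_bound_def by blast
qed

theorem theorem25:
  fixes h :: "real ^ 'n \<Rightarrow> real"
    and grad_h :: "real ^ 'n \<Rightarrow> real ^ 'n"
    and xbar :: "real ^ 'n"
    and x :: "nat \<Rightarrow> real ^ 'n"
    and \<gamma> L \<theta> \<beta> :: real
  assumes "\<gamma> > 0" and "L > 0"
    and "\<And>z. GDERIV h z :> grad_h z"
    and "L-lipschitz_on UNIV grad_h"
    and "strongly_quasiconvex \<gamma> h"
    and "{z. is_arg_min h (\<lambda>_. True) z} = {xbar}"
    and "\<theta> \<in> {0<..<1}"
    and "\<beta> \<in> {0<..(1 - \<theta>\<^sup>2) / L}"
    and "heavy_ball \<theta> \<beta> grad_h x"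
  shows "geometric_bound (\<lambda>k. norm (x k - xbar)) \<and> geometric_bound (\<lambda>k. h (x k) - h xbar)"
proof -
  have "is_arg_min h (\<lambda>_. True) xbar" using assms(6) by blast
  then have min: "h xbar \<le> h y" for y by (simp add: is_arg_min_linorder)
  have \<theta>: "0 < \<theta>" "\<theta> < 1" and \<beta>: "0 < \<beta>" using assms(7,8) by auto
  have \<beta>L: "\<beta> * L \<le> 1 - \<theta>\<^sup>2" using assms(2,8) by (simp add: field_simps)
  \<comment> \<open>At index 0 truncated subtraction gives \<open>x (0 - 1) = x 0\<close>, so
    \<open>W 0\<close> is just the gap in values; the contraction is claimed from index 1
    on.\<close>
  define W where "W = (\<lambda>k. h (x k) - h xbar + \<theta> / (2 * \<beta>) * (norm (x k - x (k - 1)))\<^sup>2)"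
  have A: "0 \<le> 4 / \<gamma> + 8 * L / \<gamma>\<^sup>2" using assms(1,2) by simp
  obtain q where q: "0 < q" "q < 1" and contr: "\<And>y d d'. d' = \<theta> *\<^sub>R d - \<beta> *\<^sub>R grad_h y \<Longrightarrow>
      h (y + d') - h xbar + \<theta> / (2 * \<beta>) * (norm d')\<^sup>2 \<le> q * (h y - h xbar + \<theta> / (2 * \<beta>) * (norm d)\<^sup>2)"
    using heavy_ball_energy_contraction[OF assms(3,4) \<theta> \<beta> \<beta>L A
        strongly_quasiconvex_polyak_lojasiewicz[OF assms(3,4,5) min]] by blast
  have "W (Suc k) \<le> q * W k" if "k \<ge> 1" for k
  proof -
    have "x (Suc k) - x k = \<theta> *\<^sub>R (x k - x (k - 1)) - \<beta> *\<^sub>R grad_h (x k)"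
      using assms(9) that by (simp add: heavy_ball_def)
    from contr[OF this] show ?thesis by (simp add: W_def)
  qed
  then have "geometric_bound W" by (rule geometric_bound_of_contraction[OF q])
  then have vals: "geometric_bound (\<lambda>k. h (x k) - h xbar)"
    by (rule geometric_bound_mono) (use \<theta> \<beta> in \<open>simp add: W_def\<close>)
  moreover have "geometric_bound (\<lambda>k. norm (x k - xbar))"
    using strongly_quasiconvex_quadratic_growth[OF assms(5) min] assms(1)
    by (intro geometric_bound_of_square[OF vals, of "8 / \<gamma>"]) auto
  ultimately show ?thesis by blast
qed

end
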